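(* Let $F$ be Thompson's group, $X=\{x_0^{\pm1},x_1^{\pm1}\}$ and $\Lambda=\{a,b,\#\}$. Then $(F,X,\Lambda)$ is $\mathcal C$-graph automatic, where $\mathcal C$ is the class of deterministic non-blind $1$-counter languages.
   Context: Thompson's group $F$ is the group with presentation $\langle x_0,x_1,x_2,\dots \mid x_jx_i=x_ix_{j+1}\text{ whenever } i<j\rangle$; it is generated by $x_0,x_1$. Convolution: let $\Lambda$ be a finite set of symbols, $\diamond\notin\Lambda$ a symbol, and $\Lambda_\diamond=\Lambda\cup\{\diamond\}$. For $u,v\in\Lambda^*$, the convolution $\otimes(u,v)$ is the string of length $\max(|u|,|v|)$ over the alphabet $(\Lambda_\diamond)^2$ whose $i$th letter is $\binom{\lambda_1}{\lambda_2}$, where $\lambda_1$ is the $i$th letter of $u$ if $i\le|u|$ and $\diamond$ otherwise, and $\lambda_2$ is the $i$th letter of $v$ if $i\le|v|$ and $\diamond$ otherwise. Normal form: let $G$ be a group with symmetric generating set $X$. A normal form for $(G,X,\Lambda)$ is a set $L\subseteq\Lambda^*$ together with a bijection $L\to G$, written $u\mapsto\overline u$. $\mathcal C$-graph automatic: for a formal language class $\mathcal C$, $(G,X,\Lambda)$ is $\mathcal C$-graph automatic if there is a normal form $L\subseteq\Lambda^*$ in the class $\mathcal C$ such that for each $x\in X$ the language $L_x=\{\otimes(u,v)\mid u,v\in L,\ \overline v=_G\overline u x\}$ is in the class $\mathcal C$. Deterministic non-blind $1$-counter language: a language accepted by a non-blind deterministic $1$-counter automaton, i.e. a deterministic finite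 state automaton augmented with an integer counter. The counter is initialized to zero, and can be incremented, decremented, compared to zero (transitions may be conditioned on the counter being $=0$, $>0$ or $<0$) and set to zero during operation. For each configuration of the machine and subsequent input letter, there is at most one possible move. The automaton accepts a word exactly if upon reading the word it reaches an accepting state with the counter equal to zero. *)

theory Defs
  imports "HOL-Algebra.Generated_Groups"
begin

section \<open>Groups given by presentations\<close>

text \<open>
  The letter \<open>(g, True)\<close> stands for the generator \<open>g\<close>, and \<open>(g, False)\<close> for its formal inverse.
  The set \<open>R\<close> contains pairs of words \<open>(u, v)\<close>, read as defining relations \<open>u = v\<close>;
  every element of the type \<open>'g\<close> is a generator.
\<close>

type_synonym 'g gword = "('g \<times> bool) list"

inductive pres_eq :: "('g gword \<times> 'g gword) set \<Rightarrow> 'g gword \<Rightarrow> 'g gword \<Rightarrow> bool"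
  for R where
  refl: "pres_eq R u u"
| sym: "pres_eq R u v \<Longrightarrow> pres_eq R v u"
| trans: "pres_eq R u v \<Longrightarrow> pres_eq R v w \<Longrightarrow> pres_eq R u w"
| append: "pres_eq R u u' \<Longrightarrow> pres_eq R v v' \<Longrightarrow> pres_eq R (u @ v) (u' @ v')"
| cancel: "pres_eq R [(g, s), (g, \<not> s)] []"
| relation: "(u, v) \<in> R \<Longrightarrow> pres_eq R u v"

definition pres_rel :: "('g gword \<times> 'g gword) set \<Rightarrow> ('g gword \<times> 'g gword) set" where
  "pres_rel R = {(u, v). pres_eq R u v}"

definition word_class :: "('g gword \<times> 'g gword) set \<Rightarrow> 'g gword \<Rightarrow> 'g gword set" where
  "word_class R w = pres_rel R `` {w}"

definition presented_group :: "('g gword \<times> 'g gword) set \<Rightarrow> 'g gword set monoid" where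
  "presented_group R =
    \<lparr> carrier = UNIV // pres_rel R,
      mult = (\<lambda>A B. \<Union>u\<in>A. \<Union>v\<in>B. word_class R (u @ v)),
      one = word_class R [] \<rparr>"

lemma equiv_pres_rel: "equiv UNIV (pres_rel R)"
proof (rule equivI)
  show "refl (pres_rel R)"
    by (rule refl_onI) (simp add: pres_rel_def pres_eq.refl)
  show "sym (pres_rel R)"
    by (rule symI) (simp add: pres_rel_def pres_eq.sym)
  show "trans (pres_rel R)"
    by (rule transI) (unfold pres_rel_def, blast dest: pres_eq.trans)
qed simp

lemma word_class_eq_iff: "word_class R u = word_class R v \<longleftrightarrow> pres_eq R u v"
  using eq_equiv_class_iff[OF equiv_pres_rel, of u v R]
  by (simp add: word_class_def pres_rel_def)

lemma carrier_presented_group: "carrier (presented_group R) = range (word_class R)"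
  by (auto simp: presented_group_def word_class_def quotient_def)

lemma mult_presented_group:
  "word_class R u \<otimes>\<^bsub>presented_group R\<^esub> word_class R v = word_class R (u @ v)"
proof -
  have "word_class R (u' @ v') = word_class R (u @ v)"
    if "u' \<in> word_class R u" "v' \<in> word_class R v" for u' v'
  proof -
    have "pres_eq R u u'" "pres_eq R v v'"
      using that by (simp_all add: word_class_def pres_rel_def)
    then show ?thesis
      unfolding word_class_eq_iff by (blast intro: pres_eq.append[THEN pres_eq.sym])
  qed
  then have "(\<Union>u'\<in>word_class R u. \<Union>v'\<in>word_class R v. word_class R (u' @ v')) =
      (\<Union>u'\<in>word_class R u. \<Union>v'\<in>word_class R v. word_class R (u @ v))"
    by (intro SUP_cong HOL.refl) blast
  moreover have "u \<in> word_class R u" "v \<in> word_class R v"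
    by (simp_all add: word_class_def pres_rel_def pres_eq.refl)
  ultimately show ?thesis
    by (force simp: presented_group_def)
qed

lemma one_presented_group: "\<one>\<^bsub>presented_group R\<^esub> = word_class R []"
  by (simp add: presented_group_def)

lemma pres_eq_inverse: "pres_eq R (rev (map (\<lambda>(g, s). (g, \<not> s)) w) @ w) []"
proof (induction w)
  case Nil
  show ?case by (simp add: pres_eq.refl)
next
  case (Cons x w)
  obtain g s where x: "x = (g, s)" by force
  let ?w = "rev (map (\<lambda>(g, s). (g, \<not> s)) w)"
  have "pres_eq R (?w @ ([(g, \<not> s), (g, s)] @ w)) (?w @ ([] @ w))"
    using pres_eq.cancel[of R g "\<not> s"]
    by (intro pres_eq.append pres_eq.refl) simp
  then have "pres_eq R (?w @ ([(g, \<not> s), (g, s)] @ w)) []"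
    using Cons.IH by (simp add: pres_eq.trans)
  then show ?case by (simp add: x)
qed

lemma group_presented_group: "group (presented_group R)"
proof (rule groupI)
  fix x assume "x \<in> carrier (presented_group R)"
  then obtain w where w: "x = word_class R w"
    by (auto simp: carrier_presented_group)
  show "\<exists>y\<in>carrier (presented_group R). y \<otimes>\<^bsub>presented_group R\<^esub> x = \<one>\<^bsub>presented_group R\<^esub>"
    by (rule bexI[of _ "word_class R (rev (map (\<lambda>(g, s). (g, \<not> s)) w))"])
       (auto simp: w carrier_presented_group mult_presented_group one_presented_group
          word_class_eq_iff pres_eq_inverse)
qed (auto simp: carrier_presented_group mult_presented_group one_presented_group)


section \<open>Thompson's group\<close>

definition thompson_relations :: "(nat gword \<times> nat gword) set" where
  "thompson_relations =
    {([(j, True), (i, True)], [(i, True), (j + 1, True)]) | i j. i < j}"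

definition thompson_F :: "nat gword set monoid" where
  "thompson_F = presented_group thompson_relations"

definition thompson_gen :: "nat \<Rightarrow> nat gword set" where
  "thompson_gen n = word_class thompson_relations [(n, True)]"

definition thompson_X :: "nat gword set set" where
  "thompson_X =
    {thompson_gen 0, inv\<^bsub>thompson_F\<^esub> thompson_gen 0,
     thompson_gen 1, inv\<^bsub>thompson_F\<^esub> thompson_gen 1}"


section \<open>Deterministic non-blind 1-counter automata\<close>

datatype counter_sign = Neg | Zero | Pos

datatype counter_op = Keep | Increment | Decrement | Set_Zero

fun sign_of :: "int \<Rightarrow> counter_sign" where
  "sign_of c = (if c < 0 then Neg else if c = 0 then Zero else Pos)"

fun apply_op :: "counter_op \<Rightarrow> int \<Rightarrow> int" where
  "apply_op Keep c = c"
| "apply_op Increment c = c + 1"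
| "apply_op Decrement c = c - 1"
| "apply_op Set_Zero c = 0"

text \<open>
  Each move reads one input letter. It may depend on the result of comparing the counter to zero
  (and on no other information about the counter); \<open>None\<close> means that there is no move.
\<close>

record ('q, 'a) counter_automaton =
  states :: "'q set"
  alphabet :: "'a set"
  start :: 'q
  accepting :: "'q set"
  move :: "'q \<Rightarrow> 'a \<Rightarrow> counter_sign \<Rightarrow> ('q \<times> counter_op) option"

definition counter_automaton :: "('q, 'a) counter_automaton \<Rightarrow> bool" where
  "counter_automaton M \<longleftrightarrow>
    finite (states M) \<and> finite (alphabet M) \<and> start M \<in> states M \<and> accepting M \<subseteq> states M \<and>
    (\<forall>q\<in>states M. \<forall>x\<in>alphabet M. \<forall>s q' f. move M q x s = Some (q', f) \<longrightarrow> q' \<in> states M)"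

fun run :: "('q, 'a) counter_automaton \<Rightarrow> 'q \<times> int \<Rightarrow> 'a list \<Rightarrow> ('q \<times> int) option" where
  "run M (q, c) [] = Some (q, c)"
| "run M (q, c) (x # w) =
    (case move M q x (sign_of c) of
       None \<Rightarrow> None
     | Some (q', f) \<Rightarrow> run M (q', apply_op f c) w)"

definition accepted_language :: "('q, 'a) counter_automaton \<Rightarrow> 'a list set" where
  "accepted_language M =
    {w \<in> lists (alphabet M). \<exists>q\<in>accepting M. run M (start M, 0) w = Some (q, 0)}"

text \<open>
  State sets are finite, so taking the states to be natural numbers loses no generality.
\<close>

definition det_counter_language :: "'a list set \<Rightarrow> bool" where
  "det_counter_language L \<longleftrightarrow>
    (\<exists>M :: (nat, 'a) counter_automaton. counter_automaton M \<and> L = accepted_language M)"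


section \<open>Graph automatic groups\<close>

text \<open>The padding symbol is \<open>None\<close>; a letter \<open>l\<close> of the original alphabet becomes \<open>Some l\<close>.\<close>

definition convolution :: "'l list \<Rightarrow> 'l list \<Rightarrow> ('l option \<times> 'l option) list" where
  "convolution u v =
    map (\<lambda>i. (if i < length u then Some (u ! i) else None,
              if i < length v then Some (v ! i) else None))
      [0..<max (length u) (length v)]"

definition symmetric_generating_set :: "('g, 'm) monoid_scheme \<Rightarrow> 'g set \<Rightarrow> bool" where
  "symmetric_generating_set G X \<longleftrightarrow>
    X \<subseteq> carrier G \<and> (\<forall>x\<in>X. inv\<^bsub>G\<^esub> x \<in> X) \<and> generate G X = carrier G"

definition normal_form ::
  "('g, 'm) monoid_scheme \<Rightarrow> 'l set \<Rightarrow> 'l list set \<Rightarrow> ('l list \<Rightarrow> 'g) \<Rightarrow> bool" where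
  "normal_form G \<Lambda> L \<phi> \<longleftrightarrow> L \<subseteq> lists \<Lambda> \<and> bij_betw \<phi> L (carrier G)"

definition multiplier_language ::
  "('g, 'm) monoid_scheme \<Rightarrow> 'l list set \<Rightarrow> ('l list \<Rightarrow> 'g) \<Rightarrow> 'g
    \<Rightarrow> ('l option \<times> 'l option) list set" where
  "multiplier_language G L \<phi> x =
    {convolution u v | u v. u \<in> L \<and> v \<in> L \<and> \<phi> v = \<phi> u \<otimes>\<^bsub>G\<^esub> x}"

text \<open>
  A language class contains languages over different alphabets. It is therefore passed twice: as
  \<open>C\<close> for languages over the symbols of \<open>\<Lambda>\<close>, and as \<open>C2\<close> for languages over pairs of padded
  symbols. Both arguments are meant to be instances of one polymorphic predicate.
\<close>

definition graph_automatic ::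
  "('l list set \<Rightarrow> bool) \<Rightarrow> (('l option \<times> 'l option) list set \<Rightarrow> bool)
    \<Rightarrow> ('g, 'm) monoid_scheme \<Rightarrow> 'g set \<Rightarrow> 'l set \<Rightarrow> bool" where
  "graph_automatic C C2 G X \<Lambda> \<longleftrightarrow>
    group G \<and> symmetric_generating_set G X \<and> finite \<Lambda> \<and>
    (\<exists>L \<phi>. normal_form G \<Lambda> L \<phi> \<and> C L \<and> (\<forall>x\<in>X. C2 (multiplier_language G L \<phi> x)))"

datatype thompson_symbol = sym_a | sym_b | sym_hash

definition thompson_\<Lambda> :: "thompson_symbol set" where
  "thompson_\<Lambda> = {sym_a, sym_b, sym_hash}"

end

theory Submission
  imports Defs
begin

text \<open>
  Every element of Thompson's group can be written uniquely as
  \<open>x\<^sub>0\<^sup>e\<^sup>0 x\<^sub>1\<^sup>e\<^sup>1 \<dots> x\<^sub>n\<^sup>e\<^sup>n x\<^sub>n\<^sup>-\<^sup>f\<^sup>n \<dots> x\<^sub>1\<^sup>-\<^sup>f\<^sup>1 x\<^sub>0\<^sup>-\<^sup>f\<^sup>0\<close>, where the last block \<open>(e\<^sub>n, f\<^sub>n)\<close> is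
  not \<open>(0, 0)\<close>, and where a block with both exponents positive is followed by a block other than
  \<open>(0, 0)\<close>. The list of blocks is spelled as the word \<open>a\<^sup>e\<^sup>0 b\<^sup>f\<^sup>0 # a\<^sup>e\<^sup>1 b\<^sup>f\<^sup>1 # \<dots>\<close>, every block being
  closed by \<open>#\<close>; these words form a regular language.

  Right multiplication by \<open>x\<^sub>j\<^sup>-\<^sup>1\<close> moves this letter to the left through the negative part. Passing
  \<open>x\<^sub>i\<^sup>-\<^sup>f\<close> with \<open>i < j\<close> raises its index by \<open>f\<close>, so that, measured relative to the block which is being
  passed, the index changes by \<open>f - 1\<close>. At the first block where the relative index is \<open>0\<close> the letter
  stops. There either a \<open>b\<close> is added to the block, or the new inverse cancels against a positive letter
  and the following empty block disappears. Hence a counter that goes up with every \<open>b\<close> and down with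
  every \<open>#\<close> finds the place of the change, and from that place on the two words differ by a shift of one
  or two letters, which a finite control can check. If one word ends before this place, the rest of the
  other one consists of empty blocks and a block with a single letter, and the counter determines the
  number of empty blocks. This is \<open>descend_rel_iff_mul_inv\<close> together with \<open>tape_automaton\<close>.
  Multiplication by \<open>x\<^sub>j\<close> is the converse relation, which is recognised by exchanging the two tracks.

  That distinct normal forms are distinct elements follows from an action: on lists of blocks,
  multiplication by \<open>x\<^sub>j\<^sup>-\<^sup>1\<close> and by \<open>x\<^sub>j\<close> are mutually inverse and satisfy the defining relations
  (\<open>mul_word_cong\<close>), and the group word of \<open>w\<close> carries the empty list to \<open>w\<close> (\<open>mul_word_word_from\<close>).
\<close>

section \<open>Lists of blocks\<close>

definition first_block :: "(nat \<times> nat) list \<Rightarrow> nat \<times> nat" where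
  "first_block w = (if w = [] then (0, 0) else hd w)"

text \<open>
  Lists are identified with sequences of blocks that are eventually \<open>(0, 0)\<close>; this constructor keeps
  them free of trailing empty blocks, and \<open>first_block\<close> and \<open>tl\<close> are its destructors even at the
  empty list.
\<close>

definition block_cons :: "nat \<times> nat \<Rightarrow> (nat \<times> nat) list \<Rightarrow> (nat \<times> nat) list" where
  "block_cons p w = (if p = (0, 0) \<and> w = [] then [] else p # w)"

lemma first_block_simps [simp]:
  "first_block [] = (0, 0)" "first_block (p # w) = p" "first_block (block_cons p w) = p"
  by (auto simp: first_block_def block_cons_def)

lemma tl_block_cons [simp]: "tl (block_cons p w) = w"
  by (auto simp: block_cons_def)

fun reduced :: "(nat \<times> nat) list \<Rightarrow> bool" where
  "reduced [] \<longleftrightarrow> True"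
| "reduced ((e, f) # w) \<longleftrightarrow> reduced w \<and> (w = [] \<longrightarrow> (e, f) \<noteq> (0, 0)) \<and>
     (e > 0 \<and> f > 0 \<longrightarrow> first_block w \<noteq> (0, 0))"

lemma reduced_block_cons [simp]:
  "reduced (block_cons (e, f) w) \<longleftrightarrow> reduced w \<and> (e > 0 \<and> f > 0 \<longrightarrow> first_block w \<noteq> (0, 0))"
  by (auto simp: block_cons_def)

lemma reduced_tl: "reduced w \<Longrightarrow> reduced (tl w)"
  by (cases w rule: reduced.cases) auto

lemma block_cons_first_tl: "reduced w \<Longrightarrow> block_cons (first_block w) (tl w) = w"
  by (cases w rule: reduced.cases) (auto simp: block_cons_def)

lemma reduced_cases:
  assumes "reduced w"
  obtains e f w' where "w = block_cons (e, f) w'" "reduced w'" "e > 0 \<and> f > 0 \<longrightarrow> first_block w' \<noteq> (0, 0)"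
  using assms block_cons_first_tl[OF assms] reduced_tl[OF assms] reduced_block_cons
  by (metis surj_pair)

section \<open>The action on lists of blocks\<close>

text \<open>
  The letter \<open>x\<^sub>j\<^sup>-\<^sup>1\<close> descends through the blocks, its index being taken relative to the current
  block. The first branch of the base case is the rewriting
  \<open>x\<^sub>0\<^sup>e w x\<^sub>0\<^sup>-\<^sup>1 = x\<^sub>0\<^sup>e\<^sup>-\<^sup>1 (x\<^sub>0 w x\<^sub>0\<^sup>-\<^sup>1)\<close>, where \<open>w\<close> involves no \<open>x\<^sub>1\<close>, so that the conjugation lowers all indices
  of \<open>w\<close> by one.
\<close>

function mul_inv :: "nat \<Rightarrow> (nat \<times> nat) list \<Rightarrow> (nat \<times> nat) list" where
  "mul_inv 0 w =
     (case first_block w of (e, f) \<Rightarrow>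
        if e > 0 \<and> f = 0 \<and> first_block (tl w) = (0, 0)
        then block_cons (e - 1, 0) (tl (tl w))
        else block_cons (e, f + 1) (tl w))"
| "mul_inv (Suc j) w = block_cons (first_block w) (mul_inv (j + snd (first_block w)) (tl w))"
  by pat_completeness auto
termination
  by (relation "measures [\<lambda>(j, w). length w, \<lambda>(j, w). j]") (auto simp: first_block_def)

function mul_gen :: "nat \<Rightarrow> (nat \<times> nat) list \<Rightarrow> (nat \<times> nat) list" where
  "mul_gen 0 w =
     (case first_block w of (e, f) \<Rightarrow>
        if f > 0 then block_cons (e, f - 1) (tl w)
        else block_cons (e + 1, 0) (block_cons (0, 0) (tl w)))"
| "mul_gen (Suc j) w = block_cons (first_block w) (mul_gen (j + snd (first_block w)) (tl w))"
  by pat_completeness auto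
termination
  by (relation "measures [\<lambda>(j, w). length w, \<lambda>(j, w). j]") (auto simp: first_block_def)

lemma first_block_mul_pos:
  "0 < j \<Longrightarrow> first_block (mul_inv j w) = first_block w"
  "0 < j \<Longrightarrow> first_block (mul_gen j w) = first_block w"
  by (cases j; simp)+

lemma reduced_mul_inv: "reduced w \<Longrightarrow> reduced (mul_inv j w)"
proof (induction j w rule: mul_inv.induct)
  case (1 w)
  then obtain e f w' where "w = block_cons (e, f) w'" "reduced w'"
    "e > 0 \<and> f > 0 \<longrightarrow> first_block w' \<noteq> (0, 0)"
    by (rule reduced_cases)
  then show ?case by (auto simp: reduced_tl)
next
  case (2 j w)
  from 2(2) obtain e f w' where "w = block_cons (e, f) w'" "reduced w'"
    "e > 0 \<and> f > 0 \<longrightarrow> first_block w' \<noteq> (0, 0)"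
    by (rule reduced_cases)
  then show ?case using 2(1) by (auto simp: first_block_mul_pos)
qed

lemma reduced_mul_gen: "reduced w \<Longrightarrow> reduced (mul_gen j w)"
proof (induction j w rule: mul_gen.induct)
  case (1 w)
  then obtain e f w' where "w = block_cons (e, f) w'" "reduced w'"
    "e > 0 \<and> f > 0 \<longrightarrow> first_block w' \<noteq> (0, 0)"
    by (rule reduced_cases)
  then show ?case by (auto simp: reduced_tl)
next
  case (2 j w)
  from 2(2) obtain e f w' where "w = block_cons (e, f) w'" "reduced w'"
    "e > 0 \<and> f > 0 \<longrightarrow> first_block w' \<noteq> (0, 0)"
    by (rule reduced_cases)
  then show ?case using 2(1) by (auto simp: first_block_mul_pos)
qed

lemma mul_inv_mul_gen: "reduced w \<Longrightarrow> mul_inv j (mul_gen j w) = w"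
proof (induction j w rule: mul_gen.induct)
  case (1 w)
  then obtain e f w' where "w = block_cons (e, f) w'" "reduced w'"
    "e > 0 \<and> f > 0 \<longrightarrow> first_block w' \<noteq> (0, 0)"
    by (rule reduced_cases)
  then show ?case by auto
next
  case (2 j w)
  then show ?case by (simp add: reduced_tl block_cons_first_tl)
qed

lemma mul_gen_mul_inv: "reduced w \<Longrightarrow> mul_gen j (mul_inv j w) = w"
proof (induction j w rule: mul_inv.induct)
  case (1 w)
  then obtain e f w' where w: "w = block_cons (e, f) w'" "reduced w'"
    by (rule reduced_cases)
  then show ?case using block_cons_first_tl[OF w(2)] by auto
next
  case (2 j w)
  then show ?case by (simp add: reduced_tl block_cons_first_tl)
qed

text \<open>
  This is the inverse of the defining relation \<open>x\<^sub>j x\<^sub>i = x\<^sub>i x\<^sub>j\<^sub>+\<^sub>1\<close>. Both letters descend in parallel until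
  the one with the smaller index stops. If it adds to the exponent \<open>f\<close> of the block, or
  removes the next block, then in either case the passage of the other letter is altered by exactly
  one index.
\<close>

lemma mul_inv_relation: "i < j \<Longrightarrow> mul_inv j (mul_inv i w) = mul_inv i (mul_inv (Suc j) w)"
proof (induction i w arbitrary: j rule: mul_inv.induct)
  case (1 w)
  then obtain j' where "j = Suc j'" by (cases j) auto
  then show ?case by (auto simp: first_block_mul_pos split: prod.splits)
next
  case (2 i w)
  then obtain j' where j: "j = Suc j'" by (cases j) auto
  then show ?case using 2(1)[of "j' + snd (first_block w)"] 2(2) by simp
qed

text \<open>
  Both sides are carried to \<open>w\<close> by \<open>mul_inv j \<circ> mul_inv i\<close>, which is injective on reduced lists.
\<close>

lemma mul_gen_relation:
  assumes "i < j" "reduced w"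
  shows "mul_gen i (mul_gen j w) = mul_gen (Suc j) (mul_gen i w)"
proof -
  let ?v = "mul_gen (Suc j) (mul_gen i w)"
  have v: "reduced ?v" using assms by (intro reduced_mul_gen)
  have "mul_inv j (mul_inv i ?v) = mul_inv i (mul_inv (Suc j) ?v)"
    by (rule mul_inv_relation) fact
  also have "\<dots> = w"
    using assms by (simp add: mul_inv_mul_gen reduced_mul_gen del: mul_inv.simps mul_gen.simps)
  finally have "mul_gen i (mul_gen j (mul_inv j (mul_inv i ?v))) = mul_gen i (mul_gen j w)"
    by simp
  then show ?thesis using v
    by (simp add: mul_gen_mul_inv reduced_mul_inv del: mul_inv.simps mul_gen.simps)
qed

definition mul_letter :: "(nat \<times> nat) list \<Rightarrow> nat \<times> bool \<Rightarrow> (nat \<times> nat) list" where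
  "mul_letter w l = (if snd l then mul_gen (fst l) w else mul_inv (fst l) w)"

abbreviation mul_word :: "(nat \<times> nat) list \<Rightarrow> nat gword \<Rightarrow> (nat \<times> nat) list" where
  "mul_word \<equiv> foldl mul_letter"

lemma reduced_mul_word: "reduced w \<Longrightarrow> reduced (mul_word w u)"
  by (induction u arbitrary: w) (auto simp: mul_letter_def reduced_mul_gen reduced_mul_inv)

lemma mul_word_cong:
  assumes "pres_eq thompson_relations u v" "reduced w"
  shows "mul_word w u = mul_word w v"
  using assms
proof (induction arbitrary: w rule: pres_eq.induct)
  case (append u u' v v')
  then show ?case by (simp add: reduced_mul_word)
next
  case (cancel g s)
  then show ?case by (cases s) (simp_all add: mul_letter_def mul_gen_mul_inv mul_inv_mul_gen)
next
  case (relation u v)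
  then show ?case
    by (auto simp: thompson_relations_def mul_letter_def mul_gen_relation)
qed auto

section \<open>Lists of blocks as group elements\<close>

fun word_from :: "nat \<Rightarrow> (nat \<times> nat) list \<Rightarrow> nat gword" where
  "word_from k [] = []"
| "word_from k ((e, f) # w) =
     replicate e (k, True) @ word_from (Suc k) w @ replicate f (k, False)"

lemma word_from_block_cons [simp]: "word_from k (block_cons (e, f) w) =
   replicate e (k, True) @ word_from (Suc k) w @ replicate f (k, False)"
  by (simp add: block_cons_def)

abbreviation feq :: "nat gword \<Rightarrow> nat gword \<Rightarrow> bool" (infix "\<approx>" 50) where
  "u \<approx> v \<equiv> pres_eq thompson_relations u v"

lemmas [trans] = pres_eq.trans

lemma feq_context: "u \<approx> v \<Longrightarrow> p @ u @ q \<approx> p @ v @ q"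
  by (intro pres_eq.append pres_eq.refl)

lemma feq_append: "u \<approx> v \<Longrightarrow> u @ q \<approx> v @ q"
  by (intro pres_eq.append pres_eq.refl)

lemma feq_prepend: "u \<approx> v \<Longrightarrow> p @ u \<approx> p @ v"
  by (intro pres_eq.append pres_eq.refl)

lemma feq_cancel_left: "(k, s) # (k, \<not> s) # u \<approx> u"
  using feq_append[OF pres_eq.cancel, of k s u] by simp

text \<open>
  For a positive letter this is a defining relation solved for \<open>x\<^sub>i\<close>. The negative letter is obtained by
  inverting it.
\<close>

lemma conjugate_letter:
  assumes "k < i"
  shows "[(k, True), (Suc i, s), (k, False)] \<approx> [(i, s)]"
proof -
  have rel: "[(k, True), (Suc i, True)] \<approx> [(i, True), (k, True)]"
    using assms by (intro pres_eq.sym[OF pres_eq.relation]) (auto simp: thompson_relations_def)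
  have pos: "[(k, True), (Suc i, True), (k, False)] \<approx> [(i, True)]"
    using pres_eq.trans[OF feq_append[OF rel, of "[(k, False)]"]]
      feq_prepend[OF pres_eq.cancel[of _ k True], of "[(i, True)]"] by simp
  have "[(i, False)] \<approx> [(i, False)] @ [(k, True), (Suc i, True), (Suc i, False), (k, False)]"
    using feq_context[OF pres_eq.cancel[of _ "Suc i" True], of "[(i, False), (k, True)]" "[(k, False)]"]
      feq_prepend[OF pres_eq.cancel[of _ k True], of "[(i, False)]"]
    by (simp, blast intro: pres_eq.trans pres_eq.sym)
  also have "\<dots> \<approx> [(i, False)] @ [(i, True), (k, True), (Suc i, False), (k, False)]"
    using feq_context[OF rel, of "[(i, False)]" "[(Suc i, False), (k, False)]"] by simp
  also have "\<dots> \<approx> [(k, True), (Suc i, False), (k, False)]"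
    using feq_cancel_left[of i False] by simp
  finally show ?thesis using pos by (cases s) (auto intro: pres_eq.sym)
qed

lemma conjugate_word:
  assumes "\<forall>l\<in>set u. k < fst l"
  shows "(k, True) # map (apfst Suc) u @ [(k, False)] \<approx> u"
  using assms
proof (induction u)
  case Nil
  then show ?case using pres_eq.cancel[of _ k True] by simp
next
  case (Cons l u)
  obtain i s where l: "l = (i, s)" by force
  have "(k, True) # map (apfst Suc) (l # u) @ [(k, False)] \<approx>
      [(k, True), (Suc i, s)] @ [(k, False), (k, True)] @ map (apfst Suc) u @ [(k, False)]"
    using feq_context[OF pres_eq.sym[OF pres_eq.cancel[of _ k False]],
        of "[(k, True), (Suc i, s)]" "map (apfst Suc) u @ [(k, False)]"] by (simp add: l)
  also have "\<dots> \<approx> [(i, s)] @ u"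
    using pres_eq.append[OF conjugate_letter[of k i s] Cons.IH] Cons.prems by (simp add: l)
  finally show ?case by (simp add: l)
qed

lemma word_from_Suc: "word_from (Suc k) w = map (apfst Suc) (word_from k w)"
  by (induction k w rule: word_from.induct) auto

lemma word_from_indices: "l \<in> set (word_from k w) \<Longrightarrow> k \<le> fst l"
  by (induction k w rule: word_from.induct) (auto simp: Suc_le_eq)

text \<open>
  The origin of the counter: each \<open>x\<^sub>k\<^sup>-\<^sup>1\<close> that is passed raises the index by one.
\<close>

lemma inverse_past_inverse_power:
  assumes "k < i"
  shows "replicate f (k, False) @ [(i, False)] \<approx> (i + f, False) # replicate f (k, False)"
  using assms
proof (induction f arbitrary: i)
  case 0
  then show ?case by (simp add: pres_eq.refl)
next
  case (Suc f)
  have 1: "[(k, False), (i, False)] \<approx> [(Suc i, False), (k, False)]"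
    using feq_prepend[OF pres_eq.sym[OF conjugate_letter[OF Suc.prems, of False]], of "[(k, False)]"]
      feq_cancel_left[of k False "[(Suc i, False), (k, False)]"]
    by (auto intro: pres_eq.trans)
  have "replicate (Suc f) (k, False) @ [(i, False)] =
     replicate f (k, False) @ [(k, False), (i, False)]"
    by (simp add: replicate_append_same[symmetric])
  also have "\<dots> \<approx> (replicate f (k, False) @ [(Suc i, False)]) @ [(k, False)]"
    using feq_prepend[OF 1, of "replicate f (k, False)"] by simp
  also have "\<dots> \<approx> ((Suc i + f, False) # replicate f (k, False)) @ [(k, False)]"
    using Suc.prems by (intro feq_append Suc.IH) simp
  finally show ?case by (simp add: replicate_append_same)
qed

lemma word_from_mul_inv:
  assumes "reduced w"
  shows "word_from k w @ [(k + j, False)] \<approx> word_from k (mul_inv j w)"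
  using assms
proof (induction j w arbitrary: k rule: mul_inv.induct)
  case (1 w)
  then obtain e f w' where w: "w = block_cons (e, f) w'" "reduced w'"
    by (rule reduced_cases)
  show ?case
  proof (cases "e > 0 \<and> f = 0 \<and> first_block w' = (0, 0)")
    case True
    then obtain e' where e: "e = Suc e'" by (cases e) auto
    have w': "w' = block_cons (0, 0) (tl w')"
      using w True block_cons_first_tl by metis
    have "word_from k w @ [(k, False)] =
        replicate e' (k, True) @ ((k, True) # map (apfst Suc) (word_from (Suc k) (tl w')) @ [(k, False)])"
      using True by (simp add: w(1) e word_from_Suc[symmetric] replicate_append_same[symmetric])
        (subst w', simp)
    also have "\<dots> \<approx> replicate e' (k, True) @ word_from (Suc k) (tl w')"
      by (intro feq_prepend conjugate_word) (auto dest: word_from_indices)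
    finally show ?thesis using True by (simp add: w(1) e)
  next
    case False
    then show ?thesis by (auto simp add: w(1) pres_eq.refl replicate_append_same)
  qed
next
  case (2 j w)
  from 2(2) obtain e f w' where w: "w = block_cons (e, f) w'" "reduced w'"
    by (rule reduced_cases)
  have "word_from k w @ [(k + Suc j, False)] =
      (replicate e (k, True) @ word_from (Suc k) w') @ (replicate f (k, False) @ [(k + Suc j, False)])"
    by (simp add: w(1))
  also have "\<dots> \<approx> (replicate e (k, True) @ word_from (Suc k) w') @
       ((k + Suc j + f, False) # replicate f (k, False))"
    by (intro feq_prepend inverse_past_inverse_power) simp
  also have "\<dots> = replicate e (k, True) @ (word_from (Suc k) w' @ [(Suc k + (j + f), False)]) @ replicate f (k, False)"
    by (simp add: ac_simps)
  also have "\<dots> \<approx> replicate e (k, True) @ word_from (Suc k) (mul_inv (j + f) w') @ replicate f (k, False)"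
    using 2(1)[of "Suc k"] w by (intro feq_context) simp
  finally show ?case by (simp add: w(1))
qed

lemma word_from_mul_letter:
  assumes "reduced w"
  shows "word_from 0 w @ [l] \<approx> word_from 0 (mul_letter w l)"
proof -
  obtain j s where l: "l = (j, s)" by force
  have *: "word_from 0 w @ [(j, True)] \<approx> word_from 0 (mul_gen j w)"
  proof -
    let ?v = "mul_gen j w"
    have "word_from 0 w @ [(j, True)] \<approx> (word_from 0 ?v @ [(j, False)]) @ [(j, True)]"
      using word_from_mul_inv[of ?v 0 j] assms
      by (intro feq_append) (simp add: reduced_mul_gen mul_inv_mul_gen pres_eq.sym)
    also have "\<dots> \<approx> word_from 0 ?v"
      using feq_prepend[OF pres_eq.cancel[of _ j False], of "word_from 0 ?v"] by simp
    finally show ?thesis .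
  qed
  show ?thesis
    using * word_from_mul_inv[OF assms, of 0 j] by (cases s) (auto simp: l mul_letter_def)
qed

lemma word_from_mul_word:
  "reduced w \<Longrightarrow> word_from 0 w @ u \<approx> word_from 0 (mul_word w u)"
proof (induction u arbitrary: w)
  case Nil
  then show ?case by (simp add: pres_eq.refl)
next
  case (Cons l u)
  have "word_from 0 w @ l # u \<approx> word_from 0 (mul_letter w l) @ u"
    using feq_append[OF word_from_mul_letter[OF Cons.prems], of l u] by simp
  also have "\<dots> \<approx> word_from 0 (mul_word (mul_letter w l) u)"
    using Cons.prems by (intro Cons.IH) (simp add: mul_letter_def reduced_mul_gen reduced_mul_inv)
  finally show ?case by simp
qed

text \<open>
  With no negative letters in the first block, an index keeps its distance to the
  second block while the first one is passed.
\<close>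

lemma mul_word_shift:
  "mul_word (block_cons (e, 0) w) (map (apfst Suc) u) = block_cons (e, 0) (mul_word w u)"
  by (induction u arbitrary: w) (auto simp: mul_letter_def)

lemma mul_word_positive:
  "mul_word (block_cons (e, 0) []) (replicate n (0, True)) = block_cons (e + n, 0) []"
proof (induction n arbitrary: e)
  case (Suc n)
  have "mul_letter (block_cons (e, 0) []) (0, True) = block_cons (Suc e, 0) []"
    by (simp add: mul_letter_def block_cons_def)
  then show ?case by (simp add: Suc)
qed simp

lemma mul_word_negative:
  assumes "n > 0 \<and> e > 0 \<longrightarrow> first_block w \<noteq> (0, 0)"
  shows "mul_word (block_cons (e, f) w) (replicate n (0, False)) = block_cons (e, f + n) w"
  using assms
proof (induction n arbitrary: f)
  case (Suc n)
  then have "mul_letter (block_cons (e, f) w) (0, False) = block_cons (e, Suc f) w"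
    by (auto simp: mul_letter_def)
  then show ?case using Suc by simp
qed simp

text \<open>
  Reading the word of \<open>w\<close> builds the list \<open>w\<close> from the inside: first the positive powers
  of \<open>x\<^sub>0\<close>, then, by induction, the blocks behind them, and last the negative powers of \<open>x\<^sub>0\<close>, which never
  cancel because \<open>w\<close> is reduced.
\<close>

lemma mul_word_word_from:
  "reduced w \<Longrightarrow> mul_word [] (word_from 0 w) = w"
proof (induction w)
  case (Cons p w)
  obtain e f where p: "p = (e, f)" by force
  from Cons have IH: "mul_word [] (word_from 0 w) = w" by (simp add: p)
  have nil: "[] = block_cons (0, 0) []" by (simp add: block_cons_def)
  have "mul_word [] (replicate e (0, True)) = block_cons (e, 0) []"
    using mul_word_positive[of 0 e] by (simp add: nil[symmetric])
  then have "mul_word [] (word_from 0 (p # w)) = mul_word (block_cons (e, 0) w) (replicate f (0, False))"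
    by (simp add: p word_from_Suc mul_word_shift IH)
  also have "\<dots> = block_cons p w"
    using Cons.prems by (subst mul_word_negative) (auto simp: p)
  also have "\<dots> = p # w" using Cons.prems by (auto simp: p block_cons_def)
  finally show ?case .
qed simp

definition element :: "(nat \<times> nat) list \<Rightarrow> nat gword set" where
  "element w = word_class thompson_relations (word_from 0 w)"

lemma bij_betw_element: "bij_betw element (Collect reduced) (carrier thompson_F)"
proof (rule bij_betw_imageI)
  show "inj_on element (Collect reduced)"
  proof (rule inj_onI)
    fix w w' assume w: "w \<in> Collect reduced" "w' \<in> Collect reduced" and "element w = element w'"
    then have "word_from 0 w \<approx> word_from 0 w'"
      by (simp add: element_def word_class_eq_iff)
    then have "mul_word [] (word_from 0 w) = mul_word [] (word_from 0 w')"
      by (rule mul_word_cong) simp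
    then show "w = w'" using w by (simp add: mul_word_word_from)
  qed
  have "word_class thompson_relations u = element (mul_word [] u)" for u
    using word_from_mul_word[of "[]" u] by (simp add: element_def word_class_eq_iff)
  moreover have "reduced (mul_word [] u)" for u
    by (simp add: reduced_mul_word)
  ultimately show "element ` Collect reduced = carrier thompson_F"
    by (force simp: thompson_F_def carrier_presented_group element_def)
qed

lemma group_thompson_F: "group thompson_F"
  by (simp add: thompson_F_def group_presented_group)

lemma word_class_in_carrier [simp]: "word_class thompson_relations u \<in> carrier thompson_F"
  by (simp add: thompson_F_def carrier_presented_group)

lemma inv_thompson_gen: "inv\<^bsub>thompson_F\<^esub> thompson_gen n = word_class thompson_relations [(n, False)]"
proof -
  interpret group thompson_F by (rule group_thompson_F)
  have "word_class thompson_relations [(n, False)] \<otimes>\<^bsub>thompson_F\<^esub> thompson_gen n = \<one>\<^bsub>thompson_F\<^esub>"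
    using pres_eq.cancel[of thompson_relations n False]
    by (simp add: thompson_F_def thompson_gen_def mult_presented_group one_presented_group word_class_eq_iff)
  then show ?thesis
    by (intro inv_equality) (simp_all add: thompson_gen_def)
qed

lemma mult_inv_gen_iff:
  assumes "reduced w" "reduced w'"
  shows "element w' = element w \<otimes>\<^bsub>thompson_F\<^esub> inv\<^bsub>thompson_F\<^esub> thompson_gen j \<longleftrightarrow> w' = mul_inv j w"
proof -
  have "element w \<otimes>\<^bsub>thompson_F\<^esub> inv\<^bsub>thompson_F\<^esub> thompson_gen j = element (mul_inv j w)"
    using word_from_mul_inv[OF assms(1), of 0 j]
    unfolding inv_thompson_gen element_def
    by (simp add: thompson_F_def mult_presented_group word_class_eq_iff)
  moreover have "inj_on element (Collect reduced)"
    using bij_betw_element by (rule bij_betw_imp_inj_on)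
  ultimately show ?thesis
    using assms by (auto simp: inj_on_def reduced_mul_inv)
qed

lemma mult_gen_iff:
  assumes "reduced w" "reduced w'"
  shows "element w' = element w \<otimes>\<^bsub>thompson_F\<^esub> thompson_gen j \<longleftrightarrow> w = mul_inv j w'"
proof -
  interpret group thompson_F by (rule group_thompson_F)
  have "element w' = element w \<otimes>\<^bsub>thompson_F\<^esub> thompson_gen j \<longleftrightarrow>
      element w = element w' \<otimes>\<^bsub>thompson_F\<^esub> inv\<^bsub>thompson_F\<^esub> thompson_gen j"
    by (rule iffI) (simp_all add: element_def thompson_gen_def m_assoc)
  then show ?thesis using mult_inv_gen_iff[of w' w j] assms by simp
qed

text \<open>
  The relation \<open>x\<^sub>m x\<^sub>0 = x\<^sub>0 x\<^sub>m\<^sub>+\<^sub>1\<close> for \<open>m > 0\<close> expresses \<open>x\<^sub>m\<^sub>+\<^sub>1\<close> by \<open>x\<^sub>m\<close> and \<open>x\<^sub>0\<close>.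
\<close>

lemma symmetric_generating_set_thompson_X: "symmetric_generating_set thompson_F thompson_X"
proof -
  interpret group thompson_F by (rule group_thompson_F)
  have gen: "thompson_gen n \<in> carrier thompson_F" for n
    by (simp add: thompson_gen_def)
  have X: "thompson_X \<subseteq> carrier thompson_F" by (auto simp: thompson_X_def gen)
  have "thompson_gen n \<in> generate thompson_F thompson_X" for n
  proof (induction n rule: less_induct)
    case (less n)
    show ?case
    proof (cases "n \<le> 1")
      case True
      then show ?thesis by (intro generate.incl) (auto simp: thompson_X_def le_Suc_eq)
    next
      case False
      then obtain m where n: "n = Suc m" "0 < m" by (cases n) auto
      have 0: "thompson_gen 0 \<in> generate thompson_F thompson_X"
          "inv\<^bsub>thompson_F\<^esub> thompson_gen 0 \<in> generate thompson_F thompson_X"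
        by (auto intro: generate.incl simp: thompson_X_def)
      have "thompson_gen m \<otimes>\<^bsub>thompson_F\<^esub> thompson_gen 0 = thompson_gen 0 \<otimes>\<^bsub>thompson_F\<^esub> thompson_gen n"
        unfolding thompson_gen_def thompson_F_def mult_presented_group word_class_eq_iff
        by (rule pres_eq.relation) (use n in \<open>auto simp: thompson_relations_def\<close>)
      then have "thompson_gen n = inv\<^bsub>thompson_F\<^esub> thompson_gen 0 \<otimes>\<^bsub>thompson_F\<^esub>
          (thompson_gen m \<otimes>\<^bsub>thompson_F\<^esub> thompson_gen 0)"
        by (simp add: gen inv_solve_left)
      then show ?thesis using less[of m] n 0 by (auto intro: generate.eng)
    qed
  qed
  then have letter: "word_class thompson_relations [(n, s)] \<in> generate thompson_F thompson_X" for n s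
    using generate_m_inv_closed[OF X, of "thompson_gen n"]
    by (cases s) (simp_all add: inv_thompson_gen, simp add: thompson_gen_def)
  have "word_class thompson_relations u \<in> generate thompson_F thompson_X" for u
  proof (induction u)
    case Nil
    then show ?case
      using generate.one[of thompson_F thompson_X] by (simp add: thompson_F_def one_presented_group)
  next
    case (Cons l u)
    then show ?case
      using generate.eng[OF letter[of "fst l" "snd l"] Cons]
      by (simp add: thompson_F_def mult_presented_group)
  qed
  then have "generate thompson_F thompson_X = carrier thompson_F"
    using generate_incl[OF X] by (auto simp: thompson_F_def carrier_presented_group)
  then show ?thesis
    using X by (auto simp: symmetric_generating_set_def thompson_X_def gen)
qed

section \<open>Closure properties of deterministic counter languages\<close>

text \<open>
  Acceptance by structural recursion on the input, over an arbitrary state type; this is the form in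
  which the languages of all configurations can be determined simultaneously by induction.
\<close>

fun accepts ::
  "('q \<Rightarrow> 'a \<Rightarrow> counter_sign \<Rightarrow> ('q \<times> counter_op) option) \<Rightarrow> 'q set \<Rightarrow> 'q \<Rightarrow> int \<Rightarrow> 'a list \<Rightarrow> bool" where
  "accepts \<delta> F q c [] \<longleftrightarrow> q \<in> F \<and> c = 0"
| "accepts \<delta> F q c (x # w) \<longleftrightarrow>
     (case \<delta> q x (sign_of c) of None \<Rightarrow> False | Some (q', f) \<Rightarrow> accepts \<delta> F q' (apply_op f c) w)"

lemma det_counter_languageI:
  fixes \<delta> :: "'q::finite \<Rightarrow> 'a::finite \<Rightarrow> counter_sign \<Rightarrow> ('q \<times> counter_op) option"
  shows "det_counter_language {w. accepts \<delta> F q0 0 w}"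
proof -
  obtain h :: "'q \<Rightarrow> nat" where h: "inj h"
    using finite_imp_inj_to_nat_seg[OF finite_UNIV] by auto
  define M where "M = \<lparr>states = range h, alphabet = UNIV, start = h q0, accepting = h ` F,
     move = \<lambda>q x s. map_option (apfst h) (\<delta> (inv_into UNIV h q) x s)\<rparr>"
  have "counter_automaton M"
    by (auto simp: counter_automaton_def M_def)
  moreover have "(\<exists>q'\<in>accepting M. run M (h q, c) w = Some (q', 0)) \<longleftrightarrow> accepts \<delta> F q c w" for q c w
  proof (induction w arbitrary: q c)
    case Nil
    then show ?case using h by (auto simp: M_def inj_image_mem_iff)
  next
    case (Cons x w)
    then show ?case
      using h by (auto simp: M_def split: option.split)
  qed
  then have "accepted_language M = {w. accepts \<delta> F q0 0 w}"
    by (auto simp: accepted_language_def) (auto simp: M_def)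
  ultimately show ?thesis
    unfolding det_counter_language_def by blast
qed

lemma accepts_product:
  "accepts (\<lambda>(q, d) x s. map_option (\<lambda>(q', f). ((q', \<eta> d x), f)) (\<delta> q x s)) (F \<times> D) (q, d) c w \<longleftrightarrow>
     accepts \<delta> F q c w \<and> foldl \<eta> d w \<in> D"
  by (induction w arbitrary: q d c) (auto split: option.split)

lemma det_counter_language_inter_regular:
  fixes \<delta> :: "'q::finite \<Rightarrow> 'a::finite \<Rightarrow> counter_sign \<Rightarrow> ('q \<times> counter_op) option"
    and \<eta> :: "'d::finite \<Rightarrow> 'a \<Rightarrow> 'd"
  shows "det_counter_language {w. accepts \<delta> F q0 0 w \<and> foldl \<eta> d0 w \<in> D}"
  unfolding accepts_product[symmetric] by (rule det_counter_languageI)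

lemma det_counter_language_regular:
  fixes \<eta> :: "'d::finite \<Rightarrow> 'a::finite \<Rightarrow> 'd"
  shows "det_counter_language {w. foldl \<eta> d0 w \<in> D}"
proof -
  have "accepts (\<lambda>q x s. Some (q, Keep)) UNIV () 0 w" for w :: "'a list"
    by (induction w) auto
  then show ?thesis
    using det_counter_language_inter_regular[of "\<lambda>q x s. Some (q, Keep)" UNIV "()" \<eta> d0 D] by simp
qed

lemma det_counter_language_map:
  fixes h :: "'a::finite \<Rightarrow> 'b::finite"
  assumes "bij h" "det_counter_language L"
  shows "det_counter_language (map h ` L)"
proof -
  obtain M :: "(nat, 'a) counter_automaton" where M: "counter_automaton M" "L = accepted_language M"
    using assms(2) by (auto simp: det_counter_language_def)
  define N :: "(nat, 'b) counter_automaton" where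
    "N = \<lparr>states = states M, alphabet = h ` alphabet M, start = start M, accepting = accepting M,
       move = \<lambda>q x. move M q (inv_into UNIV h x)\<rparr>"
  have h: "inv_into UNIV h (h x) = x" for x using assms(1) by (simp add: bij_is_inj)
  have "counter_automaton N"
    using M(1) by (auto simp: counter_automaton_def N_def h)
  moreover have run: "run N s (map h w) = run M s w" for s w
  proof (induction w arbitrary: s)
    case Nil
    then show ?case by (cases s) simp
  next
    case (Cons x w)
    then show ?case by (cases s) (auto simp: N_def h split: option.split)
  qed
  have alphabet: "x \<in> h ` alphabet M \<longleftrightarrow> inv_into UNIV h x \<in> alphabet M" for x
    using assms(1) h
    by (auto simp: image_iff bij_is_surj surj_f_inv_f intro!: bexI[of _ "inv_into UNIV h x"])
  have "map h ` L = accepted_language N"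
  proof (rule Set.set_eqI)
    fix w
    have inv: "map h (map (inv_into UNIV h) w) = w"
      using assms(1) by (simp add: o_def bij_is_surj surj_f_inv_f map_idI)
    have "w \<in> map h ` L \<longleftrightarrow> map (inv_into UNIV h) w \<in> L"
      using inv h by (auto simp: o_def image_iff intro: bexI[of _ "map (inv_into UNIV h) w"])
    also have "\<dots> \<longleftrightarrow> w \<in> accepted_language N"
      using run[of "(start M, 0)" "map (inv_into UNIV h) w"] assms(1)
      unfolding inv by (simp add: M(2) accepted_language_def in_lists_conv_set)
        (simp add: N_def alphabet)
    finally show "w \<in> map h ` L \<longleftrightarrow> w \<in> accepted_language N" .
  qed
  ultimately show ?thesis unfolding det_counter_language_def by blast
qed

section \<open>Convolutions\<close>

lemma convolution_simps [simp]:
  "convolution [] [] = []"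
  "convolution (a # u) (b # v) = (Some a, Some b) # convolution u v"
  "convolution (a # u) [] = (Some a, None) # convolution u []"
  "convolution [] (b # v) = (None, Some b) # convolution [] v"
  by (simp_all add: convolution_def upt_conv_Cons map_Suc_upt[symmetric] o_def del: upt_Suc)

lemma convolution_eq_Cons:
  "convolution u v = (x, y) # w \<longleftrightarrow>
     (case x of
        None \<Rightarrow> (case y of None \<Rightarrow> False | Some b \<Rightarrow> \<exists>v'. u = [] \<and> v = b # v' \<and> w = convolution [] v')
      | Some a \<Rightarrow> (case y of
          None \<Rightarrow> \<exists>u'. u = a # u' \<and> v = [] \<and> w = convolution u' []
        | Some b \<Rightarrow> \<exists>u' v'. u = a # u' \<and> v = b # v' \<and> w = convolution u' v'))"
  by (cases u; cases v) (auto split: option.splits)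

lemma convolution_eq_Nil: "convolution u v = [] \<longleftrightarrow> u = [] \<and> v = []"
  by (cases u; cases v) auto

lemma convolution_swap: "map prod.swap (convolution u v) = convolution v u"
  by (auto simp: convolution_def max.commute)

text \<open>
  Ignoring padding lets a finite automaton for single words run on one track of a convolution.
\<close>

definition skip_padding :: "('d \<Rightarrow> 'a \<Rightarrow> 'd) \<Rightarrow> 'd \<Rightarrow> 'a option \<Rightarrow> 'd" where
  "skip_padding \<eta> d x = (case x of None \<Rightarrow> d | Some a \<Rightarrow> \<eta> d a)"

lemma foldl_skip_padding_convolution:
  "foldl (\<lambda>(d, d') (x, y). (skip_padding \<eta> d x, skip_padding \<eta> d' y)) (d, d') (convolution u v) =
     (foldl \<eta> d u, foldl \<eta> d' v)"
proof (induction u v arbitrary: d d' rule: list_induct2')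
  case (2 x xs)
  show ?case
    by (induction xs arbitrary: d x) (auto simp: skip_padding_def)
next
  case (3 y ys)
  show ?case
    by (induction ys arbitrary: d' y) (auto simp: skip_padding_def)
qed (auto simp: skip_padding_def)

section \<open>The regular language of normal forms\<close>

instance thompson_symbol :: finite
proof
  show "finite (UNIV :: thompson_symbol set)"
    by (rule finite_subset[of _ "{sym_a, sym_b, sym_hash}"]) (auto intro: thompson_symbol.exhaust)
qed

fun encode :: "(nat \<times> nat) list \<Rightarrow> thompson_symbol list" where
  "encode [] = []"
| "encode ((e, f) # w) = replicate e sym_a @ replicate f sym_b @ sym_hash # encode w"

text \<open>
  What has been read of the current block, or, at the start of a block, what the previous blocks
  demand: nothing (\<open>Fresh\<close>), at least one more block because the last one was empty (\<open>Empty\<close>), or a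
  non-empty block because the last one contained both letters (\<open>Owed\<close>).
\<close>

datatype block_state = Fresh | Empty | Owed | As | Bs | AsBs | Dead

instance block_state :: finite
proof
  show "finite (UNIV :: block_state set)"
    by (rule finite_subset[of _ "{Fresh, Empty, Owed, As, Bs, AsBs, Dead}"]) (auto intro: block_state.exhaust)
qed

fun block_step :: "block_state \<Rightarrow> thompson_symbol \<Rightarrow> block_state" where
  "block_step Fresh sym_a = As"
| "block_step Fresh sym_b = Bs"
| "block_step Fresh sym_hash = Empty"
| "block_step Empty sym_a = As"
| "block_step Empty sym_b = Bs"
| "block_step Empty sym_hash = Empty"
| "block_step Owed sym_a = As"
| "block_step Owed sym_b = Bs"
| "block_step As sym_a = As"
| "block_step As sym_b = AsBs"
| "block_step As sym_hash = Fresh"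
| "block_step Bs sym_b = Bs"
| "block_step Bs sym_hash = Fresh"
| "block_step AsBs sym_b = AsBs"
| "block_step AsBs sym_hash = Owed"
| "block_step _ _ = Dead"

text \<open>
  The words that lead from a state to acceptance are the spellings of these lists. Inside a block, one
  possible beginning of the block, of least length, is put back in front.
\<close>

fun completes :: "block_state \<Rightarrow> (nat \<times> nat) list \<Rightarrow> bool" where
  "completes Fresh w \<longleftrightarrow> reduced w"
| "completes Empty w \<longleftrightarrow> reduced w \<and> w \<noteq> []"
| "completes Owed w \<longleftrightarrow> reduced w \<and> first_block w \<noteq> (0, 0)"
| "completes As ((e, f) # w) \<longleftrightarrow> reduced ((Suc e, f) # w)"
| "completes Bs ((e, f) # w) \<longleftrightarrow> e = 0 \<and> reduced ((0, Suc f) # w)"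
| "completes AsBs ((e, f) # w) \<longleftrightarrow> e = 0 \<and> reduced ((1, Suc f) # w)"
| "completes _ _ \<longleftrightarrow> False"

lemma completes_Nil: "completes q [] \<longleftrightarrow> q = Fresh"
  by (cases q) auto

lemma completes_step:
  "completes (block_step q sym_a) w \<longleftrightarrow> (\<exists>e f v. w = (e, f) # v \<and> completes q ((Suc e, f) # v))"
  "completes (block_step q sym_b) w \<longleftrightarrow> (\<exists>f v. w = (0, f) # v \<and> completes q ((0, Suc f) # v))"
  "completes (block_step q sym_hash) w \<longleftrightarrow> completes q ((0, 0) # w)"
  by (cases q; cases w rule: reduced.cases; auto)+

lemma encode_eq_Nil [simp]: "encode w = [] \<longleftrightarrow> w = []" "[] = encode w \<longleftrightarrow> w = []"
  by (cases w rule: encode.cases; auto)+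

text \<open>
  Removing the first letter of the spelling of a list again leaves the spelling of
  a list, which makes induction over words possible.
\<close>

lemma encode_eq_Cons:
  "x # u = encode w \<longleftrightarrow>
    (case x of
      sym_a \<Rightarrow> (\<exists>e f w'. w = (Suc e, f) # w' \<and> u = encode ((e, f) # w'))
    | sym_b \<Rightarrow> (\<exists>f w'. w = (0, Suc f) # w' \<and> u = encode ((0, f) # w'))
    | sym_hash \<Rightarrow> (\<exists>w'. w = (0, 0) # w' \<and> u = encode w'))"
proof (cases w rule: encode.cases)
  case (2 e f w')
  then show ?thesis
    by (cases e; cases f; cases x) auto
qed (auto split: thompson_symbol.split)

lemma replicate_append_cancel:
  assumes "replicate n x @ y # u = replicate n' x @ y' # u'" "x \<noteq> y" "x \<noteq> y'"
  shows "n = n' \<and> y # u = y' # u'"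
  using assms(1)
proof (induction n arbitrary: n')
  case 0
  then show ?case using assms(2,3) by (cases n') simp_all
next
  case (Suc n)
  then show ?case using assms(2,3) by (cases n') simp_all
qed

lemma encode_block_inject:
  "encode ((e, f) # w) = encode ((e', f') # w') \<longleftrightarrow> e = e' \<and> f = f' \<and> encode w = encode w'"
proof
  let ?bs = "\<lambda>f w. replicate f sym_b @ sym_hash # encode w"
  assume eq: "encode ((e, f) # w) = encode ((e', f') # w')"
  have hd: "\<exists>y u. ?bs f w = y # u \<and> y \<noteq> sym_a" for f w
    by (cases f) simp_all
  obtain y u where 1: "?bs f w = y # u" "y \<noteq> sym_a" using hd by blast
  obtain y' u' where 2: "?bs f' w' = y' # u'" "y' \<noteq> sym_a" using hd by blast
  have "e = e' \<and> ?bs f w = ?bs f' w'"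
    using replicate_append_cancel[of e sym_a y u e' y' u'] eq 1 2 by simp
  then show "e = e' \<and> f = f' \<and> encode w = encode w'"
    using replicate_append_cancel[of f sym_b sym_hash "encode w" f' sym_hash "encode w'"] by simp
qed simp

lemma encode_inject [simp]: "encode w = encode w' \<longleftrightarrow> w = w'"
proof (induction w arbitrary: w')
  case Nil
  then show ?case by auto
next
  case (Cons p w)
  show ?case
  proof (cases w')
    case Nil
    then show ?thesis by simp
  next
    case (Cons p' v)
    then show ?thesis
      using Cons.IH[of v] encode_block_inject[of "fst p" "snd p" w "fst p'" "snd p'" v]
      by (simp add: prod_eq_iff del: encode.simps)
  qed
qed

lemma block_automaton:
  "foldl block_step q u \<in> {Fresh} \<longleftrightarrow> (\<exists>w. completes q w \<and> u = encode w)"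
proof (induction u arbitrary: q)
  case Nil
  then show ?case by (auto simp: completes_Nil)
next
  case (Cons x u)
  have "(\<exists>w. completes (block_step q x) w \<and> u = encode w) \<longleftrightarrow> (\<exists>w. completes q w \<and> x # u = encode w)"
    unfolding encode_eq_Cons by (cases x; simp add: completes_step del: encode.simps; blast)
  then show ?case using Cons.IH by simp
qed

section \<open>Comparing a normal form with its multiple\<close>

text \<open>
  The automaton reads \<open>u\<close> on the left track and \<open>v\<close> on the right one. In the \<open>Descend\<close> states the relative
  index of the travelling letter is the counter plus one, \<open>L\<close> and \<open>R\<close> indicating that only the left or
  only the right word is left. The offset makes the initial counter \<open>0\<close> stand for the index \<open>1\<close>, and
  a negative counter signals that the letter stops in the block that starts. \<open>Site\<close> is this block, up
  to the change. From there on \<open>v\<close> is longer than \<open>u\<close> by one letter, which is remembered (\<open>Lead\<close>), or,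
  after a cancellation, which removes an \<open>a\<close> and a \<open>#\<close>, it lacks two letters of \<open>u\<close> (\<open>Trail\<close>).
\<close>

datatype tape_state = Descend | DescendL | DescendR | Site | Cancel
  | Lead thompson_symbol | Trail thompson_symbol thompson_symbol
  | LastL thompson_symbol | LastR thompson_symbol | Done

instance tape_state :: finite
proof
  have "q \<in> {Descend, DescendL, DescendR, Site, Cancel, Done} \<union> range Lead
         \<union> range (case_prod Trail) \<union> range LastL \<union> range LastR" for q
    by (cases q) auto
  then show "finite (UNIV :: tape_state set)"
    by (intro finite_subset[of UNIV "{Descend, DescendL, DescendR, Site, Cancel, Done} \<union> range Lead
         \<union> range (case_prod Trail) \<union> range LastL \<union> range LastR"]) (blast, simp)
qed

type_synonym letter_pair = "thompson_symbol option \<times> thompson_symbol option"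

definition site_move :: "letter_pair \<Rightarrow> tape_state option" where
  "site_move x =
     (if x = (Some sym_a, Some sym_a) \<or> x = (Some sym_b, Some sym_b) then Some Site
      else if x = (Some sym_hash, Some sym_b) then Some (Lead sym_hash)
      else if x = (Some sym_a, Some sym_hash) then Some Cancel
      else if x = (None, Some sym_b) then Some (LastR sym_hash)
      else if x = (Some sym_a, None) then Some (LastL sym_hash)
      else None)"

fun tape_move :: "tape_state \<Rightarrow> letter_pair \<Rightarrow> counter_sign \<Rightarrow> (tape_state \<times> counter_op) option" where
  "tape_move Descend x s =
     (if s = Neg then map_option (\<lambda>q. (q, Set_Zero)) (site_move x)
      else if x = (Some sym_a, Some sym_a) then Some (Descend, Keep)
      else if x = (Some sym_b, Some sym_b) then Some (Descend, Increment)
      else if x = (Some sym_hash, Some sym_hash) then Some (Descend, Decrement)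
      else if x = (Some sym_hash, None) then Some (DescendL, Decrement)
      else if x = (None, Some sym_hash) then Some (DescendR, Decrement)
      else None)"
| "tape_move DescendL x s =
     (if s = Neg then (if x = (Some sym_a, None) then Some (LastL sym_hash, Set_Zero) else None)
      else if x = (Some sym_hash, None) then Some (DescendL, Decrement) else None)"
| "tape_move DescendR x s =
     (if s = Neg then (if x = (None, Some sym_b) then Some (LastR sym_hash, Set_Zero) else None)
      else if x = (None, Some sym_hash) then Some (DescendR, Decrement) else None)"
| "tape_move Site x s = map_option (\<lambda>q. (q, Keep)) (site_move x)"
| "tape_move Cancel x s =
     (if fst x = Some sym_hash
      then Some (case snd x of None \<Rightarrow> Done | Some t \<Rightarrow> Trail sym_hash t, Keep) else None)"
| "tape_move (Lead r) x s =
     (if snd x = Some r then Some (case fst x of None \<Rightarrow> Done | Some t \<Rightarrow> Lead t, Keep) else None)"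
| "tape_move (Trail r t) x s =
     (if fst x = Some r then Some (case snd x of None \<Rightarrow> LastL t | Some t' \<Rightarrow> Trail t t', Keep)
      else None)"
| "tape_move (LastL r) x s = (if x = (Some r, None) then Some (Done, Keep) else None)"
| "tape_move (LastR r) x s = (if x = (None, Some r) then Some (Done, Keep) else None)"
| "tape_move Done x s = None"

text \<open>
  The rest of \<open>v\<close> is obtained from the rest of \<open>u\<close> by a change in the current block. The clauses for an
  empty word deal with a change in a block that only one of the words contains. In the last
  line \<open>v\<close> loses an \<open>a\<close> that ends its block, and the next block, which must be empty, or else the
  block is the last one of \<open>u\<close>. The order of the letters and the other conditions on normal forms do
  not appear, since both tracks are separately checked to be normal forms.
\<close>

fun site_rel :: "thompson_symbol list \<Rightarrow> thompson_symbol list \<Rightarrow> bool" where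
  "site_rel [] v \<longleftrightarrow> v = [sym_b, sym_hash]"
| "site_rel (x # u) [] \<longleftrightarrow> x = sym_a \<and> u = [sym_hash]"
| "site_rel (x # u) (y # v) \<longleftrightarrow>
     x = y \<and> x \<noteq> sym_hash \<and> site_rel u v
     \<or> x = sym_hash \<and> y = sym_b \<and> v = sym_hash # u
     \<or> x = sym_a \<and> y = sym_hash \<and> (u = [sym_hash] \<and> v = [] \<or> v \<noteq> [] \<and> u = sym_hash # sym_hash # v)"

fun descend_rel :: "nat \<Rightarrow> thompson_symbol list \<Rightarrow> thompson_symbol list \<Rightarrow> bool" where
  "descend_rel 0 u v \<longleftrightarrow> site_rel u v"
| "descend_rel (Suc j) [] v \<longleftrightarrow> v = replicate (Suc j) sym_hash @ [sym_b, sym_hash]"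
| "descend_rel (Suc j) (x # u) [] \<longleftrightarrow> x # u = replicate (Suc j) sym_hash @ [sym_a, sym_hash]"
| "descend_rel (Suc j) (x # u) (y # v) \<longleftrightarrow> x = y \<and>
     descend_rel (case x of sym_a \<Rightarrow> Suc j | sym_b \<Rightarrow> Suc (Suc j) | sym_hash \<Rightarrow> j) u v"

text \<open>
  The pairs of words that are accepted from a given configuration. The conversion by \<open>nat\<close> treats
  all negative counters alike, as the automaton does.
\<close>

fun tape_rel :: "tape_state \<Rightarrow> int \<Rightarrow> thompson_symbol list \<Rightarrow> thompson_symbol list \<Rightarrow> bool" where
  "tape_rel Descend c u v \<longleftrightarrow> descend_rel (nat (c + 1)) u v"
| "tape_rel DescendL c u v \<longleftrightarrow> v = [] \<and> u = replicate (nat (c + 1)) sym_hash @ [sym_a, sym_hash]"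
| "tape_rel DescendR c u v \<longleftrightarrow> u = [] \<and> v = replicate (nat (c + 1)) sym_hash @ [sym_b, sym_hash]"
| "tape_rel Site c u v \<longleftrightarrow> c = 0 \<and> site_rel u v"
| "tape_rel Cancel c u v \<longleftrightarrow>
     c = 0 \<and> (u = [sym_hash] \<and> v = [] \<or> v \<noteq> [] \<and> u = sym_hash # sym_hash # v)"
| "tape_rel (Lead r) c u v \<longleftrightarrow> c = 0 \<and> v = r # u"
| "tape_rel (Trail r t) c u v \<longleftrightarrow> c = 0 \<and> u = r # t # v"
| "tape_rel (LastL r) c u v \<longleftrightarrow> c = 0 \<and> u = [r] \<and> v = []"
| "tape_rel (LastR r) c u v \<longleftrightarrow> c = 0 \<and> u = [] \<and> v = [r]"
| "tape_rel Done c u v \<longleftrightarrow> c = 0 \<and> u = [] \<and> v = []"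

lemma tape_rel_Nil: "tape_rel q c [] [] \<longleftrightarrow> q = Done \<and> c = 0"
  by (cases q; cases "nat (c + 1)") auto

lemma ex_convolution_Cons:
  "(\<exists>u v. (None, None) # w = convolution u v \<and> P u v) \<longleftrightarrow> False"
  "(\<exists>u v. (None, Some b) # w = convolution u v \<and> P u v) \<longleftrightarrow>
     (\<exists>v. w = convolution [] v \<and> P [] (b # v))"
  "(\<exists>u v. (Some a, None) # w = convolution u v \<and> P u v) \<longleftrightarrow>
     (\<exists>u. w = convolution u [] \<and> P (a # u) [])"
  "(\<exists>u v. (Some a, Some b) # w = convolution u v \<and> P u v) \<longleftrightarrow>
     (\<exists>u v. w = convolution u v \<and> P (a # u) (b # v))"
  by (auto simp: eq_commute[of "_ # _" "convolution _ _"] convolution_eq_Cons)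

lemma padded_symbol_cases:
  obtains "x = None" | "x = Some sym_a" | "x = Some sym_b" | "x = Some sym_hash"
  by (metis not_None_eq thompson_symbol.exhaust)

text \<open>
  The relations \<open>tape_rel\<close> are closed under taking quotients by a letter, and the automaton follows
  these quotients; with \<open>tape_rel_Nil\<close> this determines its language by induction.
\<close>

lemma tape_step:
  "(\<exists>u v. x # w = convolution u v \<and> tape_rel q c u v) \<longleftrightarrow>
     (case tape_move q x (sign_of c) of
        None \<Rightarrow> False
      | Some (q', f) \<Rightarrow> \<exists>u v. w = convolution u v \<and> tape_rel q' (apply_op f c) u v)"
proof -
  obtain y z where x: "x = (y, z)" by force
  show ?thesis
  proof (cases "c < 0")
    case True
    then have "nat (c + 1) = 0" by simp
    with True show ?thesis
      by (cases y rule: padded_symbol_cases; cases z rule: padded_symbol_cases;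
          simp only: x ex_convolution_Cons; cases q; auto simp: site_move_def)
  next
    case False
    then obtain n where c: "c = int n"
      using nonneg_int_cases[of c] by auto
    have "nat (int n + 1) = Suc n" "nat (2 + int n) = Suc (Suc n)"
      by (simp_all add: nat_add_distrib)
    then show ?thesis unfolding c
      by (cases y rule: padded_symbol_cases; cases z rule: padded_symbol_cases;
          simp only: x ex_convolution_Cons; cases q; auto simp: site_move_def numeral_2_eq_2)
  qed
qed

lemma tape_automaton:
  "accepts tape_move {Done} q c w \<longleftrightarrow> (\<exists>u v. w = convolution u v \<and> tape_rel q c u v)"
proof (induction w arbitrary: q c)
  case Nil
  then show ?case
    by (auto simp: tape_rel_Nil eq_commute[of "[]"] convolution_eq_Nil)
next
  case (Cons x w)
  then show ?case
    unfolding tape_step by (simp split: option.split prod.split del: sign_of.simps)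
qed

lemma encode_zeros: "encode (replicate j (0, 0) @ w) = replicate j sym_hash @ encode w"
  by (induction j) auto

lemma mul_inv_Nil: "mul_inv j [] = replicate j (0, 0) @ [(0, 1)]"
  by (induction j) (auto simp: block_cons_def)

text \<open>
  Besides the two intended shapes, a lone power of \<open>a\<close> is possible for \<open>v\<close>. Among normal forms only the empty
  word has this shape, and it occurs if \<open>u\<close> ends with the block \<open>(1, 0)\<close>, which vanishes.
\<close>

lemma site_rel_block:
  "site_rel (encode ((e, f) # w)) v \<longleftrightarrow> v = encode ((e, Suc f) # w) \<or>
     e > 0 \<and> f = 0 \<and>
       (w = [] \<and> (v = replicate (e - 1) sym_a \<or> v = encode [(e - 1, 0)])
        \<or> (\<exists>w'. w = (0, 0) # w' \<and> w' \<noteq> [] \<and> v = encode ((e - 1, 0) # w')))"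
proof (induction e arbitrary: v)
  case 0
  show ?case
  proof (induction f arbitrary: v)
    case 0
    then show ?case by (cases v) simp_all
  next
    case (Suc f)
    then show ?case by (cases v) auto
  qed
next
  case (Suc e)
  have hash: "encode ((e, f) # w) = sym_hash # y \<longleftrightarrow> e = 0 \<and> f = 0 \<and> encode w = y" for y
    by (cases e; cases f) simp_all
  show ?case
  proof (cases v)
    case Nil
    then show ?thesis using hash[of "[]"] by (simp add: conj_ac)
  next
    case (Cons y v')
    show ?thesis
    proof (cases y)
      case sym_a
      then show ?thesis using Suc.IH[of v'] Cons by (cases e) simp_all
    next
      case sym_b
      then show ?thesis using Cons by (cases e) simp_all
    next
      case sym_hash
      have "site_rel (encode ((Suc e, f) # w)) v \<longleftrightarrow> e = 0 \<and> f = 0 \<and>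
          (w = [] \<and> v' = [] \<or> v' \<noteq> [] \<and> encode w = sym_hash # v')"
      proof -
        have "site_rel (encode ((Suc e, f) # w)) v \<longleftrightarrow>
            encode ((e, f) # w) = [sym_hash] \<and> v' = []
            \<or> v' \<noteq> [] \<and> encode ((e, f) # w) = sym_hash # sym_hash # v'"
          using Cons sym_hash by simp
        then show ?thesis unfolding hash encode_eq_Nil by blast
      qed
      also have "\<dots> \<longleftrightarrow> e = 0 \<and> f = 0 \<and>
          (w = [] \<and> v' = [] \<or> (\<exists>w'. w = (0, 0) # w' \<and> w' \<noteq> [] \<and> v' = encode w'))"
        using encode_eq_Cons[of sym_hash v' w] unfolding eq_commute[of "encode w"]
        by (simp only: thompson_symbol.case) (metis encode_eq_Nil(1))
      finally have "site_rel (encode ((Suc e, f) # w)) v \<longleftrightarrow> e = 0 \<and> f = 0 \<and>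
          (w = [] \<and> v' = [] \<or> (\<exists>w'. w = (0, 0) # w' \<and> w' \<noteq> [] \<and> v' = encode w'))" .
      then show ?thesis
        unfolding Cons sym_hash by (cases e; simp del: site_rel.simps; blast)
    qed
  qed
qed

lemma descend_rel_block:
  "descend_rel (Suc j) (encode ((e, f) # w)) (encode ((e', f') # w')) \<longleftrightarrow>
     e = e' \<and> f = f' \<and> descend_rel (j + f) (encode w) (encode w')"
proof (induction e arbitrary: e')
  case 0
  show ?case
  proof (cases e')
    case 0
    have "descend_rel (Suc j) (encode ((0, f) # w)) (encode ((0, f') # w')) \<longleftrightarrow>
       f = f' \<and> descend_rel (j + f) (encode w) (encode w')"
    proof (induction f arbitrary: j f')
      case 0
      then show ?case by (cases f') auto
    next
      case (Suc f)
      then show ?case by (cases f') auto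
    qed
    then show ?thesis using 0 by simp
  next
    case (Suc n)
    then show ?thesis by (cases f) auto
  qed
next
  case (Suc e)
  show ?case
  proof (cases e')
    case 0
    then show ?thesis by (cases f') auto
  next
    case (Suc n)
    then show ?thesis using Suc.IH[of n] by simp
  qed
qed

lemma descend_rel_Nil_right:
  "descend_rel j u [] \<longleftrightarrow> u = replicate j sym_hash @ [sym_a, sym_hash]"
  by (cases j; cases u) auto

text \<open>
  The heart of the matter: for normal forms, the relation that can be checked with a counter is
  multiplication by \<open>x\<^sub>j\<^sup>-\<^sup>1\<close>. Reducedness of \<open>w'\<close> decides between adding a \<open>b\<close> and cancelling.
\<close>

lemma descend_rel_iff_mul_inv:
  assumes "reduced w" "reduced w'"
  shows "descend_rel j (encode w) (encode w') \<longleftrightarrow> w' = mul_inv j w"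
  using assms
proof (induction j w arbitrary: w' rule: mul_inv.induct)
  case (1 w)
  show ?case
  proof (cases w rule: encode.cases)
    case 1
    have "[sym_b, sym_hash] = encode [(0, 1)]" by simp
    then show ?thesis by (simp add: 1 block_cons_def del: encode.simps(2))
  next
    case (2 e f w1)
    have e1: "(replicate (e - 1) sym_a = encode w') \<longleftrightarrow> e - 1 = 0 \<and> w' = []"
    proof
      assume eq: "replicate (e - 1) sym_a = encode w'"
      then have "sym_hash \<notin> set (encode w')" by (metis in_set_replicate thompson_symbol.distinct(3))
      then have "w' = []" by (cases w' rule: encode.cases) auto
      with eq show "e - 1 = 0 \<and> w' = []" by simp
    qed simp
    have "w2 \<noteq> []" if "w1 = (0, 0) # w2" for w2
      using \<open>reduced w\<close> that by (auto simp: 2)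
    then consider "w1 = []" | w2 where "w1 = (0, 0) # w2" "w2 \<noteq> []" | "first_block w1 \<noteq> (0, 0)"
      by (cases w1) auto
    then show ?thesis
      using \<open>reduced w\<close> \<open>reduced w'\<close> e1
      unfolding 2 descend_rel.simps site_rel_block encode_inject
      by cases (auto simp: block_cons_def)
  qed
next
  case (2 j w)
  show ?case
  proof (cases w rule: encode.cases)
    case 1
    have "replicate (Suc j) sym_hash @ [sym_b, sym_hash] = encode (replicate (Suc j) (0, 0) @ [(0, 1)])"
      unfolding encode_zeros by simp
    then show ?thesis by (simp add: 1 mul_inv_Nil block_cons_def del: encode.simps(2) replicate_Suc)
  next
    case (2 e f w1)
    have w1: "reduced w1" using \<open>reduced w\<close> by (simp add: 2)
    have IH: "descend_rel (j + f) (encode w1) (encode v) \<longleftrightarrow> v = mul_inv (j + f) w1" if "reduced v" for v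
      using "2.IH" w1 that by (simp add: 2)
    show ?thesis
    proof (cases w' rule: encode.cases)
      case 1
      have "encode ((e, f) # w1) = replicate (Suc j) sym_hash @ [sym_a, sym_hash] \<longleftrightarrow>
          e = 0 \<and> f = 0 \<and> descend_rel j (encode w1) []"
        unfolding descend_rel_Nil_right by (cases e; cases f) auto
      also have "\<dots> \<longleftrightarrow> e = 0 \<and> f = 0 \<and> mul_inv j w1 = []"
        using IH[of "[]"] by auto
      finally show ?thesis
        by (auto simp: 1 2 descend_rel_Nil_right block_cons_def simp del: encode.simps(2))
    next
      case (2 e' f' w1')
      then show ?thesis
        using IH[of w1'] \<open>reduced w'\<close> \<open>w = (e, f) # w1\<close>
        by (auto simp: descend_rel_block block_cons_def simp del: encode.simps(2))
    qed
  qed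
qed

lemma det_counter_language_mul_inv_if_tape_rel:
  assumes "\<And>w w'. reduced w \<Longrightarrow> reduced w' \<Longrightarrow>
    tape_rel q 0 (encode w) (encode w') \<longleftrightarrow> w' = mul_inv j w"
  shows "det_counter_language {convolution (encode w) (encode (mul_inv j w)) | w. reduced w}"
proof -
  let ?\<eta> = "\<lambda>(d, d') (x, y). (skip_padding block_step d x, skip_padding block_step d' y)"
  have "accepts tape_move {Done} q 0 s \<and> foldl ?\<eta> (Fresh, Fresh) s \<in> {Fresh} \<times> {Fresh} \<longleftrightarrow>
      (\<exists>w. s = convolution (encode w) (encode (mul_inv j w)) \<and> reduced w)" for s
  proof -
    have "accepts tape_move {Done} q 0 s \<and> foldl ?\<eta> (Fresh, Fresh) s \<in> {Fresh} \<times> {Fresh} \<longleftrightarrow>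
       (\<exists>u v. s = convolution u v \<and> tape_rel q 0 u v \<and> foldl block_step Fresh u \<in> {Fresh}
          \<and> foldl block_step Fresh v \<in> {Fresh})"
      unfolding tape_automaton by (auto simp: foldl_skip_padding_convolution) blast
    also have "\<dots> \<longleftrightarrow> (\<exists>w w'. s = convolution (encode w) (encode w') \<and> reduced w \<and> reduced w' \<and>
        w' = mul_inv j w)"
      unfolding block_automaton using assms by (simp, blast)
    finally show ?thesis using reduced_mul_inv by auto
  qed
  then show ?thesis
    using det_counter_language_inter_regular
        [of tape_move "{Done}" q ?\<eta> "(Fresh, Fresh)" "{Fresh} \<times> {Fresh}"]
    by simp
qed

text \<open>
  The bound on \<open>j\<close> comes from the initial counter, which must be \<open>0\<close>: in state \<open>Descend\<close> it stands for
  the index \<open>1\<close>, and for the index \<open>0\<close> the change takes place in the very first block.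
\<close>

lemma det_counter_language_mul_inv:
  assumes "j \<le> 1"
  shows "det_counter_language {convolution (encode w) (encode (mul_inv j w)) | w. reduced w}"
proof (cases j)
  case 0
  show ?thesis
    using descend_rel_iff_mul_inv[of _ _ 0] unfolding 0
    by (intro det_counter_language_mul_inv_if_tape_rel[of Site]) simp
next
  case (Suc i)
  then have "j = 1" using assms by simp
  then show ?thesis
    using descend_rel_iff_mul_inv[of _ _ 1]
    by (intro det_counter_language_mul_inv_if_tape_rel[of Descend]) simp
qed

section \<open>Thompson's group is graph automatic\<close>

theorem theorem3p6:
  shows "graph_automatic det_counter_language det_counter_language thompson_F thompson_X thompson_\<Lambda>"
proof -
  let ?L = "encode ` Collect reduced" and ?\<phi> = "element \<circ> the_inv encode"
  let ?M = "\<lambda>j. {convolution (encode w) (encode (mul_inv j w)) | w. reduced w}"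
  have decode [simp]: "the_inv encode (encode w) = w" for w
    by (simp add: the_inv_f_f inj_def)
  have "bij_betw (the_inv encode) ?L (Collect reduced)"
    by (rule bij_betw_byWitness[where f' = encode]) auto
  then have "bij_betw ?\<phi> ?L (carrier thompson_F)"
    using bij_betw_element by (rule bij_betw_trans)
  moreover have "u \<in> lists thompson_\<Lambda>" for u
  proof -
    have "x \<in> thompson_\<Lambda>" for x by (cases x) (simp_all add: thompson_\<Lambda>_def)
    then show ?thesis by (auto simp: in_lists_conv_set)
  qed
  ultimately have nf: "normal_form thompson_F thompson_\<Lambda> ?L ?\<phi>"
    by (auto simp: normal_form_def)
  have "?L = {u. foldl block_step Fresh u \<in> {Fresh}}"
    unfolding block_automaton by auto
  then have L: "det_counter_language ?L"
    by (simp only: det_counter_language_regular)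
  have mult: "multiplier_language thompson_F ?L ?\<phi> x =
      {convolution (encode w) (encode w') | w w'. reduced w \<and> reduced w' \<and>
         element w' = element w \<otimes>\<^bsub>thompson_F\<^esub> x}" for x
    unfolding multiplier_language_def by (rule Collect_cong) force
  have inv: "multiplier_language thompson_F ?L ?\<phi> (inv\<^bsub>thompson_F\<^esub> thompson_gen j) = ?M j" for j
    unfolding mult by (intro Collect_cong) (metis mult_inv_gen_iff reduced_mul_inv)
  \<comment> \<open>The two tracks change places, since \<open>v = u x\<^sub>j\<close> means \<open>u = v x\<^sub>j\<^sup>-\<^sup>1\<close>.\<close>
  have gen: "multiplier_language thompson_F ?L ?\<phi> (thompson_gen j) = map prod.swap ` ?M j" for j
  proof -
    have "map prod.swap ` ?M j =
        {map prod.swap (convolution (encode w) (encode (mul_inv j w))) | w. reduced w}"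
      by blast
    also have "\<dots> = {convolution (encode (mul_inv j w)) (encode w) | w. reduced w}"
      by (simp only: convolution_swap)
    also have "\<dots> = {convolution (encode w) (encode w') | w w'. reduced w \<and> reduced w' \<and>
         element w' = element w \<otimes>\<^bsub>thompson_F\<^esub> thompson_gen j}"
      by (intro Collect_cong) (metis mult_gen_iff reduced_mul_inv)
    finally show ?thesis unfolding mult by (rule HOL.sym)
  qed
  have "det_counter_language (multiplier_language thompson_F ?L ?\<phi> (thompson_gen j))"
    "det_counter_language (multiplier_language thompson_F ?L ?\<phi> (inv\<^bsub>thompson_F\<^esub> thompson_gen j))"
    if "j \<le> 1" for j
    unfolding gen inv using det_counter_language_mul_inv[OF that]
    by (auto intro!: det_counter_language_map bij_swap)
  then have "\<forall>x\<in>thompson_X. det_counter_language (multiplier_language thompson_F ?L ?\<phi> x)"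
    by (simp add: thompson_X_def)
  moreover have "finite thompson_\<Lambda>" by (simp add: thompson_\<Lambda>_def)
  ultimately show ?thesis
    unfolding graph_automatic_def
    using nf L group_thompson_F symmetric_generating_set_thompson_X by blast
qed

end
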